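(* Let $n,d\ge 1$ and let $(X_1,Y_1),\ldots,(X_n,Y_n)\in\mathbb{R}^d\times\mathbb{R}$ be arbitrary. Let $\hat\Gamma := n^{-1}\sum_{i=1}^n X_iY_i$, $\hat\Sigma := n^{-1}\sum_{i=1}^n X_iX_i^\top$, and let $\hat\beta$ be any minimizer of $\theta\mapsto n^{-1}\sum_{i=1}^n (Y_i - X_i^\top\theta)^2$ over $\theta\in\mathbb{R}^d$. For any symmetric positive definite matrix $\Sigma\in\mathbb{R}^{d\times d}$ and any vector $\beta\in\mathbb{R}^d$, setting $$\mathcal{D}^{\Sigma} := \|\Sigma^{-1/2}\hat\Sigma\Sigma^{-1/2} - I_d\|_{op},$$ we have $$(1+\mathcal{D}^\Sigma)^{-1}\,\|\Sigma^{-1}(\hat\Gamma - \hat\Sigma\beta)\|_\Sigma \;\le\; \|\hat\beta - \beta\|_\Sigma \;\le\; (1-\mathcal{D}^\Sigma)_+^{-1}\,\|\Sigma^{-1}(\hat\Gamma - \hat\Sigma\beta)\|_\Sigma.$$ Furthermore, $$\|\hat\beta - \beta - \Sigma^{-1}(\hat\Gamma - \hat\Sigma\beta)\|_\Sigma \;\le\; \mathcal{D}^\Sigma(1-\mathcal{D}^\Sigma)_+^{-1}\,\|\Sigma^{-1}(\hat\Gamma - \hat\Sigma\beta)\|_\Sigma.$$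
   Context: No assumption is made on the observations (they need not be random, and no relation between $n$ and $d$ is assumed). For a positive definite matrix $A$ and a vector $x$, $\|x\|_A := \sqrt{x^\top A x}$; $A^{1/2}$ is the symmetric positive definite square root; $\|\cdot\|_{op}$ is the operator norm induced by the Euclidean norm; $I_d$ is the $d\times d$ identity; $(t)_+ := \max\{0,t\}$. When $\mathcal{D}^\Sigma\ge 1$, a right-hand side containing $(1-\mathcal{D}^\Sigma)_+^{-1}$ is read as $+\infty$ (the bound is vacuous). *)

theory Defs
  imports "HOL-Analysis.Analysis"
begin

definition sym_posdef :: "real^'d^'d \<Rightarrow> bool" where
  "sym_posdef A \<longleftrightarrow> transpose A = A \<and> (\<forall>x. x \<noteq> 0 \<longrightarrow> 0 < x \<bullet> (A *v x))"

text \<open>For a symmetric positive definite \<open>A\<close> there is exactly one such \<open>B\<close>; for other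
  \<open>A\<close> the value is unspecified.\<close>

definition mat_sqrt :: "real^'d^'d \<Rightarrow> real^'d^'d" where
  "mat_sqrt A = (THE B. sym_posdef B \<and> B ** B = A)"

definition mat_norm :: "real^'d^'d \<Rightarrow> real^'d \<Rightarrow> real" where
  "mat_norm A x = sqrt (x \<bullet> (A *v x))"

definition op_norm :: "real^'d^'d \<Rightarrow> real" where
  "op_norm A = onorm (\<lambda>x. A *v x)"

text \<open>The observations are indexed by \<open>{1..n}\<close>; values of \<open>X\<close> and \<open>Y\<close> at other indices are
  irrelevant.\<close>

definition Gamma_hat :: "nat \<Rightarrow> (nat \<Rightarrow> real^'d) \<Rightarrow> (nat \<Rightarrow> real) \<Rightarrow> real^'d" where
  "Gamma_hat n X Y = inverse (real n) *\<^sub>R (\<Sum>i=1..n. Y i *\<^sub>R X i)"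

definition Sigma_hat :: "nat \<Rightarrow> (nat \<Rightarrow> real^'d) \<Rightarrow> real^'d^'d" where
  "Sigma_hat n X = inverse (real n) *\<^sub>R
     (\<Sum>i=1..n. (columnvector (X i) :: real^1^'d) ** rowvector (X i))"

definition ls_objective :: "nat \<Rightarrow> (nat \<Rightarrow> real^'d) \<Rightarrow> (nat \<Rightarrow> real) \<Rightarrow> real^'d \<Rightarrow> real" where
  "ls_objective n X Y \<theta> = inverse (real n) * (\<Sum>i=1..n. (Y i - X i \<bullet> \<theta>)\<^sup>2)"

definition D_Sigma :: "nat \<Rightarrow> (nat \<Rightarrow> real^'d) \<Rightarrow> real^'d^'d \<Rightarrow> real" where
  "D_Sigma n X S =
     op_norm (matrix_inv (mat_sqrt S) ** Sigma_hat n X ** matrix_inv (mat_sqrt S) - mat 1)"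

text \<open>\<open>pos_part_bound t r\<close> is the right-hand side $(t)_+^{-1} r$, where the whole product is read
  as $+\infty$ if $t \le 0$, even for \<open>r = 0\<close>. Multiplication on \<^typ>\<open>ereal\<close> cannot be used here,
  because it has \<open>\<infinity> * 0 = 0\<close>.\<close>

definition pos_part_bound :: "real \<Rightarrow> real \<Rightarrow> ereal" where
  "pos_part_bound t r = (if max 0 t = 0 then \<infinity> else ereal (inverse (max 0 t) * r))"

end

theory Submission
  imports Defs
begin

text \<open>With \<open>R = mat_sqrt \<Sigma>\<close>, put \<open>u = R(\<beta>hat - \<beta>)\<close> and let \<open>v\<close> be \<open>R\<close> applied to
  \<open>\<Sigma>\<inverse>(\<Gamma> - \<Sigma>hat \<beta>)\<close>. The normal equations give \<open>v = u + M u\<close>, where \<open>M\<close> is the matrix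
  whose operator norm is \<open>D_Sigma\<close>, and all three bounds follow from the triangle inequality.
  That \<open>mat_sqrt\<close> is meaningful rests on the spectral theorem: an orthonormal set of eigenvectors
  of maximal cardinality spans, since the Rayleigh quotient attains its maximum on the unit sphere
  of the orthogonal complement, at a further eigenvector.\<close>

section \<open>Spectral theorem for real symmetric matrices\<close>

text \<open>A derivative-free first-order condition: the quadratic is 0 at \<open>t = 0\<close>,
  hence minimal there. It serves both the Rayleigh quotient and the least-squares objective.\<close>

lemma quadratic_nonneg_linear_coeff_zero:
  fixes a c :: real
  assumes "\<And>t. 0 \<le> a * t + c * t\<^sup>2"
  shows "a = 0"
proof (rule ccontr)
  assume "a \<noteq> 0"
  \<comment> \<open>Any \<open>k > 0\<close> exceeding \<open>c\<close> makes the quadratic negative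
    at \<open>t = - a / k\<close>, whatever the sign of \<open>c\<close>.\<close>
  define k where "k = \<bar>c\<bar> + 1"
  have k: "k > 0" "c < k" by (auto simp: k_def)
  have "a * (- a / k) + c * (- a / k)\<^sup>2 = (c - k) * (a / k)\<^sup>2"
    using k by (simp add: field_simps power2_eq_square)
  also have "\<dots> < 0"
    using k \<open>a \<noteq> 0\<close> by (simp add: mult_neg_pos)
  finally show False
    using assms[of "- a / k"] by simp
qed

lemma transpose_eq_self_inner:
  fixes A :: "real^'d^'d"
  assumes "transpose A = A"
  shows "x \<bullet> (A *v y) = (A *v x) \<bullet> y"
  using dot_lmul_matrix[of x A y] assms by (metis transpose_matrix_vector)

lemma symmetric_eigenvector_in_invariant_subspace:
  fixes A :: "real^'d^'d"
  assumes sym: "transpose A = A" and sub: "subspace S"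
    and inv: "\<And>x. x \<in> S \<Longrightarrow> A *v x \<in> S" and z: "z \<in> S" "z \<noteq> 0"
  shows "\<exists>v\<in>S. \<exists>l. norm v = 1 \<and> A *v v = l *\<^sub>R v"
proof -
  have comp: "compact (S \<inter> sphere 0 1)"
    using closed_subspace[OF sub] by (simp add: closed_Int_compact)
  have "(1 / norm z) *\<^sub>R z \<in> S \<inter> sphere 0 1"
    using z sub by (simp add: subspace_scale)
  then have ne: "S \<inter> sphere 0 1 \<noteq> {}" by blast
  have cont: "continuous_on (S \<inter> sphere 0 1) (\<lambda>x. x \<bullet> (A *v x))"
    by (intro continuous_intros matrix_vector_mult_linear_continuous_on)
  obtain v where v: "v \<in> S" "norm v = 1"
    and mx: "\<And>y. y \<in> S \<Longrightarrow> norm y = 1 \<Longrightarrow> y \<bullet> (A *v y) \<le> v \<bullet> (A *v v)"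
    using continuous_attains_sup[OF comp ne cont] by auto
  define m where "m = v \<bullet> (A *v v)"
  have bound: "y \<bullet> (A *v y) \<le> m * (y \<bullet> y)" if "y \<in> S" for y
  proof (cases "y = 0")
    case False
    define y' where "y' = (1 / norm y) *\<^sub>R y"
    have "y' \<in> S" "norm y' = 1"
      using False that sub by (auto simp: y'_def subspace_scale)
    then have *: "y' \<bullet> (A *v y') \<le> m" using mx m_def by blast
    have "y = norm y *\<^sub>R y'" using False by (simp add: y'_def)
    then have "y \<bullet> (A *v y) = (norm y)\<^sup>2 * (y' \<bullet> (A *v y'))"
      by (metis inner_scaleR_left inner_scaleR_right matrix_vector_mult_scaleR mult.assoc power2_eq_square)
    also have "\<dots> \<le> (norm y)\<^sup>2 * m" using * by (simp add: mult_left_mono)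
    finally show ?thesis by (simp add: power2_norm_eq_inner mult.commute)
  qed simp
  \<comment> \<open>The residual of the eigenvector equation. Invariance keeps it in
    \<open>S\<close>, so it is an admissible direction in which to vary the maximiser
    \<open>v\<close>.\<close>
  define w where "w = m *\<^sub>R v - A *v v"
  have "w \<in> S" using v sub inv by (simp add: w_def subspace_diff subspace_scale)
  \<comment> \<open>On \<open>S\<close> the form
    \<open>m * (y \<bullet> y) - y \<bullet> (A *v y)\<close> is nonnegative and vanishes at
    \<open>v\<close>; this is its expansion along \<open>v + t w\<close>.\<close>
  have "0 \<le> (2 * (w \<bullet> w)) * t + (m * (w \<bullet> w) - w \<bullet> (A *v w)) * t\<^sup>2" for t
  proof -
    have "v + t *\<^sub>R w \<in> S" using v \<open>w \<in> S\<close> sub by (simp add: subspace_add subspace_scale)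
    from bound[OF this]
    have "0 \<le> m * ((v + t *\<^sub>R w) \<bullet> (v + t *\<^sub>R w)) - (v + t *\<^sub>R w) \<bullet> (A *v (v + t *\<^sub>R w))"
      by simp
    also have "\<dots> = (m * (v \<bullet> v) - v \<bullet> (A *v v)) + 2 * t * (m * (v \<bullet> w) - (A *v v) \<bullet> w)
        + (m * (w \<bullet> w) - w \<bullet> (A *v w)) * t\<^sup>2"
      using transpose_eq_self_inner[OF sym, of v w]
      by (simp add: matrix_vector_right_distrib matrix_vector_mult_scaleR inner_add_left
          inner_add_right inner_commute algebra_simps power2_eq_square)
    also have "m * (v \<bullet> v) - v \<bullet> (A *v v) = 0"
      using v by (simp add: m_def dot_square_norm)
    also have "m * (v \<bullet> w) - (A *v v) \<bullet> w = w \<bullet> w"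
      by (simp add: w_def inner_diff_left)
    finally show ?thesis by (simp add: algebra_simps)
  qed
  then have "2 * (w \<bullet> w) = 0" by (rule quadratic_nonneg_linear_coeff_zero)
  then have "A *v v = m *\<^sub>R v" by (simp add: w_def)
  with v show ?thesis by blast
qed

lemma symmetric_orthonormal_eigenbasis:
  fixes A :: "real^'d^'d"
  assumes sym: "transpose A = A"
  obtains E l where "finite E" "pairwise orthogonal E" "\<And>v. v \<in> E \<Longrightarrow> norm v = 1"
    "\<And>v. v \<in> E \<Longrightarrow> A *v v = l v *\<^sub>R v" "span E = UNIV"
proof -
  define P where "P E \<longleftrightarrow> pairwise orthogonal E \<and> (\<forall>v\<in>E. norm v = 1 \<and> (\<exists>c. A *v v = c *\<^sub>R v))"
    for E
  have fin: "finite E" "card E \<le> DIM(real^'d)" if "P E" for E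
  proof -
    have "independent E"
      using that unfolding P_def by (intro pairwise_orthogonal_independent) auto
    then show "finite E" "card E \<le> DIM(real^'d)"
      using independent_bound by blast+
  qed
  have "P {}" by (simp add: P_def)
  then obtain E where E: "P E" and maxE: "\<And>F. P F \<Longrightarrow> card F \<le> card E"
    using ex_has_greatest_nat[of P "{}" card "DIM(real^'d) + 1"] fin by (metis less_add_one order_le_less_trans less_imp_le)
  have "span E = UNIV"
  proof (rule ccontr)
    assume "span E \<noteq> UNIV"
    then have "span E \<subset> span UNIV" by auto
    then obtain z where z: "z \<noteq> 0" "\<And>y. y \<in> span E \<Longrightarrow> orthogonal z y"
      using orthogonal_to_subspace_exists_gen[of E UNIV] by metis
    \<comment> \<open>The orthogonal complement of \<open>E\<close> is invariant: moving
      \<open>A\<close> across the inner product turns \<open>e\<close> into a multiple of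
      itself.\<close>
    define S where "S = {x. \<forall>e\<in>E. e \<bullet> x = 0}"
    have "subspace S" by (auto simp: S_def subspace_def inner_add_right)
    moreover have "A *v x \<in> S" if "x \<in> S" for x
      unfolding S_def
    proof safe
      fix e assume "e \<in> E"
      then obtain c where "A *v e = c *\<^sub>R e" using E P_def by blast
      then show "e \<bullet> (A *v x) = 0"
        using that \<open>e \<in> E\<close> by (simp add: transpose_eq_self_inner[OF sym] S_def)
    qed
    moreover have "z \<in> S"
      using z(2) by (auto simp: S_def orthogonal_def inner_commute span_base)
    ultimately obtain v c where v: "v \<in> S" "norm v = 1" "A *v v = c *\<^sub>R v"
      using symmetric_eigenvector_in_invariant_subspace[OF sym] z(1) by blast
    have "v \<notin> E" using v by (auto simp: S_def dot_square_norm)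
    moreover have "P (insert v E)"
      using E v by (auto simp: P_def pairwise_insert orthogonal_def S_def inner_commute)
    ultimately show False
      using maxE[of "insert v E"] fin[OF E] by simp
  qed
  moreover obtain l where "\<And>v. v \<in> E \<Longrightarrow> A *v v = l v *\<^sub>R v"
    using E unfolding P_def by metis
  ultimately show ?thesis using that E fin[OF E] unfolding P_def by blast
qed

section \<open>Square roots, inverses and the weighted norm\<close>

lemma matrix_eq_on_spanning:
  fixes A B :: "real^'d^'d"
  assumes "span E = UNIV" "\<And>v. v \<in> E \<Longrightarrow> A *v v = B *v v"
  shows "A = B"
  using linear_eq_on_span[of "(*v) A" "(*v) B" E] assms
  by (metis UNIV_I matrix_eq matrix_vector_mul_linear)

text \<open>The root scales each eigenvector of \<open>A\<close> by the square root of its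
  eigenvalue, and any other root must do the same. Uniqueness is what makes the \<open>THE\<close>
  in \<open>mat_sqrt\<close> well defined.\<close>

lemma sym_posdef_square_root_unique_ex:
  fixes A :: "real^'d^'d"
  assumes A: "sym_posdef A"
  shows "\<exists>!B. sym_posdef B \<and> B ** B = A"
proof -
  have sym: "transpose A = A" using A sym_posdef_def by blast
  obtain E l where E: "finite E" "pairwise orthogonal E" "\<And>v. v \<in> E \<Longrightarrow> norm v = 1"
    and l: "\<And>v. v \<in> E \<Longrightarrow> A *v v = l v *\<^sub>R v" and sp: "span E = UNIV"
    using symmetric_orthonormal_eigenbasis[OF sym] by metis
  have lpos: "l v > 0" if "v \<in> E" for v
  proof -
    have "v \<noteq> 0" using E(3)[OF that] by auto
    then have "0 < v \<bullet> (A *v v)" using A sym_posdef_def by blast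
    then show ?thesis using l[OF that] E(3)[OF that] by (simp add: dot_square_norm)
  qed
  define f where "f x = (\<Sum>v\<in>E. (sqrt (l v) * (v \<bullet> x)) *\<^sub>R v)" for x
  define B where "B = matrix f"
  have "linear f"
    unfolding f_def
    by (intro linearI) (simp_all add: inner_add_right algebra_simps sum.distrib scaleR_sum_right)
  then have Bf: "B *v x = f x" for x by (simp add: B_def matrix_works)
  have Bv: "B *v v = sqrt (l v) *\<^sub>R v" if "v \<in> E" for v
  proof -
    have "f v = (\<Sum>w\<in>E. if w = v then sqrt (l v) *\<^sub>R v else 0)"
      unfolding f_def using that E(2,3)
      by (intro sum.cong) (auto simp: dot_square_norm pairwise_def orthogonal_def)
    then show ?thesis using that E(1) Bf by simp
  qed
  \<comment> \<open>This expression is symmetric in \<open>x\<close> and \<open>y\<close>, and for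
    \<open>x = y\<close> it is a positively weighted sum of squares.\<close>
  have inner: "x \<bullet> (B *v y) = (\<Sum>v\<in>E. sqrt (l v) * (v \<bullet> x) * (v \<bullet> y))" for x y
    by (simp add: Bf f_def inner_sum_right inner_commute mult_ac)
  have "x \<bullet> (transpose B *v y) = x \<bullet> (B *v y)" for x y
  proof -
    have "x \<bullet> (transpose B *v y) = y \<bullet> (B *v x)"
      by (metis dot_lmul_matrix inner_commute transpose_matrix_vector)
    then show ?thesis by (simp add: inner mult_ac)
  qed
  then have "transpose B = B" by (metis matrix_eq vector_eq_ldot)
  moreover have "0 < x \<bullet> (B *v x)" if x: "x \<noteq> 0" for x
  proof -
    \<comment> \<open>Otherwise \<open>x\<close> would be orthogonal to the whole space, hence to
      itself. This \<open>v\<close> gives a strictly positive summand.\<close>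
    obtain v where v: "v \<in> E" "v \<bullet> x \<noteq> 0"
    proof (rule ccontr)
      assume "\<not> thesis"
      then have "orthogonal x v" if "v \<in> E" for v
        using that \<open>\<And>v. \<lbrakk>v \<in> E; v \<bullet> x \<noteq> 0\<rbrakk> \<Longrightarrow> thesis\<close> by (auto simp: orthogonal_def inner_commute)
      then have "orthogonal x x" using orthogonal_to_span[of x E x] sp by auto
      then show False using x by (simp add: orthogonal_def)
    qed
    show ?thesis unfolding inner mult.assoc
      by (rule sum_pos2[OF E(1) v(1)]) (use v lpos in \<open>auto simp: less_imp_le power2_eq_square[symmetric]\<close>)
  qed
  ultimately have B: "sym_posdef B" unfolding sym_posdef_def by blast
  have BB: "B ** B = A"
  proof (rule matrix_eq_on_spanning[OF sp])
    fix v assume "v \<in> E"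
    then show "(B ** B) *v v = A *v v"
      using lpos[of v] by (simp add: matrix_vector_mul_assoc[symmetric] Bv l matrix_vector_mult_scaleR)
  qed
  have "C = B" if C: "sym_posdef C" "C ** C = A" for C
  proof (rule matrix_eq_on_spanning[OF sp])
    fix v assume v: "v \<in> E"
    \<comment> \<open>\<open>(C + sqrt l)(C - sqrt l) v = 0\<close>, and the first factor is positive definite.\<close>
    define s where "s = sqrt (l v)"
    have s: "s > 0" "l v = s * s" using lpos[OF v] by (auto simp: s_def)
    define w where "w = C *v v - s *\<^sub>R v"
    have "C *v (C *v v) = (s * s) *\<^sub>R v"
      using C(2) l[OF v] s by (simp add: matrix_vector_mul_assoc)
    then have "C *v w = - s *\<^sub>R w"
      by (simp add: w_def matrix_vector_mult_diff_distrib matrix_vector_mult_scaleR algebra_simps)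
    then have "w \<bullet> (C *v w) \<le> 0" using s by simp
    then have "w = 0" using C(1) unfolding sym_posdef_def by (meson not_le)
    then show "C *v v = B *v v" by (simp add: w_def s_def Bv[OF v])
  qed
  with B BB show ?thesis by blast
qed

lemma mat_sqrt:
  assumes "sym_posdef A"
  shows "sym_posdef (mat_sqrt A)" "mat_sqrt A ** mat_sqrt A = A"
  using theI'[OF sym_posdef_square_root_unique_ex[OF assms]] by (auto simp: mat_sqrt_def)

lemma sym_posdef_invertible:
  fixes A :: "real^'d^'d"
  assumes "sym_posdef A"
  shows "invertible A"
proof -
  have "x = 0" if "A *v x = 0" for x
    using assms that unfolding sym_posdef_def by (metis inner_zero_right less_irrefl)
  then show ?thesis
    by (simp add: invertible_left_inverse matrix_left_invertible_ker)
qed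

lemma matrix_inv_mult:
  fixes A :: "real^'d^'d"
  assumes "invertible A"
  shows "A ** matrix_inv A = mat 1" "matrix_inv A ** A = mat 1"
  using someI_ex[OF assms[unfolded invertible_def]] by (auto simp: matrix_inv_def)

text \<open>Moving one symmetric factor of \<open>A\<close> across the inner product reduces
  weighted norms to Euclidean ones.\<close>

lemma mat_norm_eq_norm_mat_sqrt:
  fixes A :: "real^'d^'d"
  assumes "sym_posdef A"
  shows "mat_norm A x = norm (mat_sqrt A *v x)"
proof -
  have "transpose (mat_sqrt A) = mat_sqrt A"
    using mat_sqrt(1)[OF assms] by (simp add: sym_posdef_def)
  then have "x \<bullet> (A *v x) = (mat_sqrt A *v x) \<bullet> (mat_sqrt A *v x)"
    using mat_sqrt(2)[OF assms] transpose_eq_self_inner matrix_vector_mul_assoc by metis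
  then show ?thesis by (simp add: mat_norm_def norm_eq_sqrt_inner)
qed

section \<open>Least squares and the normal equations\<close>

lemma outer_product_vector_mult:
  fixes a b x :: "real^'d"
  shows "((columnvector a :: real^1^'d) ** rowvector b) *v x = (b \<bullet> x) *\<^sub>R a"
  by (simp add: vec_eq_iff matrix_matrix_mult_def matrix_vector_mult_def columnvector_def
      rowvector_def inner_vec_def sum_distrib_left sum_distrib_right mult_ac)

lemma sum_matrix_vector_mult:
  fixes f :: "'i \<Rightarrow> real^'d^'m"
  shows "(\<Sum>i\<in>I. f i) *v x = (\<Sum>i\<in>I. f i *v x)"
  by (induction I rule: infinite_finite_induct) (simp_all add: matrix_vector_mult_add_rdistrib)

lemma Sigma_hat_vector_mult:
  "Sigma_hat n X *v x = inverse (real n) *\<^sub>R (\<Sum>i=1..n. (X i \<bullet> x) *\<^sub>R X i)"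
  by (simp add: Sigma_hat_def scaleR_matrix_vector_assoc[symmetric] sum_matrix_vector_mult
      outer_product_vector_mult)

text \<open>The vector \<open>w\<close> is half the gradient of the objective at \<open>b\<close>.
  Moving from \<open>b\<close> by \<open>t w\<close> changes the objective by
  \<open>2 t (w \<bullet> w) + q t^2\<close>, so minimality forces \<open>w = 0\<close>, even when
  \<open>Sigma_hat\<close> is singular.\<close>

lemma least_squares_normal_equations:
  assumes "is_arg_min (ls_objective n X Y) (\<lambda>\<theta>. True) b"
  shows "Sigma_hat n X *v b = Gamma_hat n X Y"
proof -
  define w where "w = Sigma_hat n X *v b - Gamma_hat n X Y"
  define q where "q = inverse (real n) * (\<Sum>i=1..n. (X i \<bullet> w)\<^sup>2)"
  have w: "w \<bullet> w = inverse (real n) * (\<Sum>i=1..n. (X i \<bullet> b - Y i) * (X i \<bullet> w))"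
  proof -
    have "w = inverse (real n) *\<^sub>R (\<Sum>i=1..n. (X i \<bullet> b - Y i) *\<^sub>R X i)"
      by (simp add: w_def Sigma_hat_vector_mult Gamma_hat_def scaleR_diff_right[symmetric]
          sum_subtractf[symmetric] scaleR_diff_left[symmetric])
    then have "w \<bullet> w = (inverse (real n) *\<^sub>R (\<Sum>i=1..n. (X i \<bullet> b - Y i) *\<^sub>R X i)) \<bullet> w"
      by simp
    then show ?thesis by (simp add: inner_sum_left)
  qed
  have "0 \<le> (2 * (w \<bullet> w)) * t + q * t\<^sup>2" for t
  proof -
    have "(Y i - X i \<bullet> (b + t *\<^sub>R w))\<^sup>2 = (Y i - X i \<bullet> b)\<^sup>2
        + 2 * t * ((X i \<bullet> b - Y i) * (X i \<bullet> w)) + t\<^sup>2 * (X i \<bullet> w)\<^sup>2" for i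
      by (simp add: inner_add_right power2_eq_square algebra_simps)
    then have "ls_objective n X Y (b + t *\<^sub>R w) = ls_objective n X Y b + 2 * t * (w \<bullet> w) + t\<^sup>2 * q"
      unfolding ls_objective_def w q_def
      by (simp only: sum.distrib sum_distrib_left[symmetric] distrib_left mult_ac)
    moreover have "ls_objective n X Y b \<le> ls_objective n X Y (b + t *\<^sub>R w)"
      using assms by (auto simp: is_arg_min_def not_less)
    ultimately show ?thesis by (simp add: algebra_simps)
  qed
  then have "2 * (w \<bullet> w) = 0" by (rule quadratic_nonneg_linear_coeff_zero)
  then show ?thesis by (simp add: w_def)
qed

section \<open>Operator norm and the error bounds\<close>

lemma norm_matrix_vector_mult_le: "norm (A *v x) \<le> op_norm A * norm x"
  unfolding op_norm_def by (rule onorm) simp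

lemma op_norm_nonneg: "0 \<le> op_norm A"
  unfolding op_norm_def by (rule onorm_pos_le) simp

text \<open>For \<open>t \<le> 0\<close> the bound is infinite, so only positive \<open>t\<close>
  has to be treated, in a form free of division.\<close>

lemma le_pos_part_bound:
  assumes "0 < t \<Longrightarrow> t * a \<le> r"
  shows "ereal a \<le> pos_part_bound t r"
  using assms by (auto simp: pos_part_bound_def max_def field_simps)

theorem theorem2p1:
  fixes n :: nat
    and X :: "nat \<Rightarrow> real^'d"
    and Y :: "nat \<Rightarrow> real"
    and \<Sigma> :: "real^'d^'d"
    and \<beta> \<beta>hat :: "real^'d"
  assumes "n \<ge> 1"
    and "is_arg_min (ls_objective n X Y) (\<lambda>\<theta>. True) \<beta>hat"
    and "sym_posdef \<Sigma>"
  shows "inverse (1 + D_Sigma n X \<Sigma>)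
           * mat_norm \<Sigma> (matrix_inv \<Sigma> *v (Gamma_hat n X Y - Sigma_hat n X *v \<beta>))
         \<le> mat_norm \<Sigma> (\<beta>hat - \<beta>)
       \<and> ereal (mat_norm \<Sigma> (\<beta>hat - \<beta>))
         \<le> pos_part_bound (1 - D_Sigma n X \<Sigma>)
             (mat_norm \<Sigma> (matrix_inv \<Sigma> *v (Gamma_hat n X Y - Sigma_hat n X *v \<beta>)))
       \<and> ereal (mat_norm \<Sigma> (\<beta>hat - \<beta> - matrix_inv \<Sigma> *v (Gamma_hat n X Y - Sigma_hat n X *v \<beta>)))
         \<le> pos_part_bound (1 - D_Sigma n X \<Sigma>)
             (D_Sigma n X \<Sigma> * mat_norm \<Sigma> (matrix_inv \<Sigma> *v (Gamma_hat n X Y - Sigma_hat n X *v \<beta>)))"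
proof -
  define R where "R = mat_sqrt \<Sigma>"
  define Q where "Q = matrix_inv R"
  define M where "M = Q ** Sigma_hat n X ** Q - mat 1"
  define D where "D = D_Sigma n X \<Sigma>"
  define g where "g = Gamma_hat n X Y - Sigma_hat n X *v \<beta>"
  define u where "u = R *v (\<beta>hat - \<beta>)"
  define v where "v = R *v (matrix_inv \<Sigma> *v g)"
  have RR: "R ** R = \<Sigma>" and "invertible R"
    using mat_sqrt[OF assms(3)] sym_posdef_invertible by (auto simp: R_def)
  then have Q: "Q ** R = mat 1"
    by (simp add: Q_def matrix_inv_mult)
  have "\<Sigma> ** matrix_inv \<Sigma> = mat 1"
    using sym_posdef_invertible[OF assms(3)] by (simp add: matrix_inv_mult)
  \<comment> \<open>Write \<open>R\<close> as \<open>Q ** R ** R\<close>, that is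
    \<open>Q ** \<Sigma>\<close>, and cancel \<Sigma> against its inverse.\<close>
  then have "R ** matrix_inv \<Sigma> = Q"
    by (metis Q RR matrix_mul_assoc matrix_mul_lid matrix_mul_rid)
  then have v: "v = Q *v g"
    by (simp add: v_def matrix_vector_mul_assoc)
  have "g = Sigma_hat n X *v (\<beta>hat - \<beta>)"
    using least_squares_normal_equations[OF assms(2)]
    by (simp add: g_def matrix_vector_mult_diff_distrib)
  also have "\<beta>hat - \<beta> = Q *v u"
    using Q by (simp add: u_def matrix_vector_mul_assoc)
  \<comment> \<open>Here \<open>v\<close> is \<open>Q ** Sigma_hat n X ** Q\<close> applied to
    \<open>u\<close>, and that matrix is \<open>mat 1 + M\<close>.\<close>
  finally have vM: "v = u + M *v u"
    by (simp add: v M_def matrix_vector_mul_assoc matrix_mul_assoc matrix_vector_mult_diff_rdistrib)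
  have D: "D = op_norm M" "D \<ge> 0"
    by (simp_all add: D_def D_Sigma_def M_def Q_def R_def op_norm_nonneg)
  have Mu: "norm (M *v u) \<le> D * norm u"
    by (simp add: D norm_matrix_vector_mult_le)
  have lower: "norm v \<le> (1 + D) * norm u"
    using Mu norm_triangle_ineq[of u "M *v u"] by (simp add: vM algebra_simps)
  have upper: "(1 - D) * norm u \<le> norm v"
    using Mu norm_diff_ineq[of u "M *v u"] by (simp add: vM algebra_simps)
  \<comment> \<open>Since \<open>u - v\<close> is \<open>- (M *v u)\<close>, its norm is at most
    \<open>D * norm u\<close>; \<open>upper\<close> then replaces \<open>u\<close> by
    \<open>v\<close>.\<close>
  have diff: "(1 - D) * norm (u - v) \<le> D * norm v" if "0 < 1 - D"
  proof -
    have "norm (u - v) \<le> D * norm u" using Mu by (simp add: vM)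
    then have "(1 - D) * norm (u - v) \<le> D * ((1 - D) * norm u)"
      using that mult_left_mono[of "norm (u - v)" "D * norm u" "1 - D"] by (simp add: mult_ac)
    also have "\<dots> \<le> D * norm v" using upper D(2) by (rule mult_left_mono)
    finally show ?thesis .
  qed
  have norms: "mat_norm \<Sigma> (matrix_inv \<Sigma> *v g) = norm v" "mat_norm \<Sigma> (\<beta>hat - \<beta>) = norm u"
    "mat_norm \<Sigma> (\<beta>hat - \<beta> - matrix_inv \<Sigma> *v g) = norm (u - v)"
    by (simp_all add: mat_norm_eq_norm_mat_sqrt[OF assms(3)] u_def v_def R_def
        matrix_vector_mult_diff_distrib)
  have "inverse (1 + D) * norm v \<le> norm u"
    using lower D(2) by (simp add: field_simps)
  then show ?thesis
    unfolding g_def[symmetric] D_def[symmetric] norms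
    using upper diff by (auto intro: le_pos_part_bound)
qed

end
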